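(* For all positive integers $r$, $k$ and $\ell$ with $1\leq \ell< k/r$, we have \[\operatorname{ind}_r(k,\ell)\leq \operatorname{ind}_{\leq r}(k,\ell)\leq \frac{k}{k-r\ell}\cdot \frac{1}{e}.\]
   Context: A hypergraph has a finite vertex set and a set of edges, each edge being a non-empty subset of the vertex set. For a hypergraph $G$ with at least $k$ vertices, let $I(G,k,\ell)$ be the probability that a uniformly random $k$-vertex subset of $V(G)$ contains (as subsets) exactly $\ell$ edges of $G$. For $r\geq 1$, $0\le \ell\le\binom{k}{r}$ and $n\geq k$, let $I_r(n,k,\ell)$ be the maximum of $I(G,k,\ell)$ over all $r$-uniform hypergraphs $G$ on $n$ vertices, and $I_{\leq r}(n,k,\ell)$ the maximum of $I(G,k,\ell)$ over all hypergraphs $G$ on $n$ vertices all of whose edges have size at most $r$. Both are non-increasing in $n$; define $\operatorname{ind}_r(k,\ell)=\lim_{n\to\infty}I_r(n,k,\ell)$ and $\operatorname{ind}_{\leq r}(k,\ell)=\lim_{n\to\infty}I_{\leq r}(n,k,\ell)$. *)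

theory Defs
  imports "HOL-Probability.Probability"
begin

definition hypergraph :: "'a set \<Rightarrow> 'a set set \<Rightarrow> bool" where
  "hypergraph V E \<longleftrightarrow> finite V \<and> (\<forall>e\<in>E. e \<subseteq> V \<and> e \<noteq> {})"

definition uniform_edges :: "nat \<Rightarrow> 'a set set \<Rightarrow> bool" where
  "uniform_edges r E \<longleftrightarrow> (\<forall>e\<in>E. card e = r)"

definition edges_size_le :: "nat \<Rightarrow> 'a set set \<Rightarrow> bool" where
  "edges_size_le r E \<longleftrightarrow> (\<forall>e\<in>E. card e \<le> r)"

text \<open>Meaningful only if \<open>V\<close> is finite with at least \<open>k\<close> elements; otherwise the
  argument of \<^const>\<open>pmf_of_set\<close> is empty or infinite.\<close>

definition I_prob :: "'a set \<Rightarrow> 'a set set \<Rightarrow> nat \<Rightarrow> nat \<Rightarrow> real" where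
  "I_prob V E k l =
     measure_pmf.prob (pmf_of_set {S. S \<subseteq> V \<and> card S = k}) {S. card {e \<in> E. e \<subseteq> S} = l}"

text \<open>Every finite hypergraph is isomorphic to one whose vertices are natural numbers,
  so the maxima range over all hypergraphs on \<open>n\<close> vertices up to isomorphism.
  The values for \<open>n < k\<close> are irrelevant to the limits below.\<close>

definition I_unif :: "nat \<Rightarrow> nat \<Rightarrow> nat \<Rightarrow> nat \<Rightarrow> real" where
  "I_unif r n k l =
     Max {I_prob V E k l | (V :: nat set) E. hypergraph V E \<and> card V = n \<and> uniform_edges r E}"

definition I_le :: "nat \<Rightarrow> nat \<Rightarrow> nat \<Rightarrow> nat \<Rightarrow> real" where
  "I_le r n k l =
     Max {I_prob V E k l | (V :: nat set) E. hypergraph V E \<and> card V = n \<and> edges_size_le r E}"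

definition ind_unif :: "nat \<Rightarrow> nat \<Rightarrow> nat \<Rightarrow> real" where
  "ind_unif r k l = lim (\<lambda>n. I_unif r n k l)"

definition ind_le :: "nat \<Rightarrow> nat \<Rightarrow> nat \<Rightarrow> real" where
  "ind_le r k l = lim (\<lambda>n. I_le r n k l)"

text \<open>For \<open>n \<ge> k\<close> the sets under \<^const>\<open>Max\<close> are finite and non-empty, and the limits
  exist. The two cases are treated together, with \<open>Q\<close> the condition on the edge sizes.\<close>

definition I_values :: "(nat \<Rightarrow> bool) \<Rightarrow> nat \<Rightarrow> nat \<Rightarrow> nat \<Rightarrow> real set" where
  "I_values Q n k l =
     {I_prob V E k l | (V :: nat set) E. hypergraph V E \<and> card V = n \<and> (\<forall>e\<in>E. Q (card e))}"

lemma I_unif_eq: "I_unif r n k l = Max (I_values (\<lambda>s. s = r) n k l)"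
  by (simp add: I_unif_def I_values_def uniform_edges_def)

lemma I_le_eq: "I_le r n k l = Max (I_values (\<lambda>s. s \<le> r) n k l)"
  by (simp add: I_le_def I_values_def edges_size_le_def)

lemma I_prob_eq:
  assumes "finite V" "k \<le> card V"
  shows "I_prob V E k l =
    card {S. S \<subseteq> V \<and> card S = k \<and> card {e \<in> E. e \<subseteq> S} = l} / (card V choose k)"
proof -
  let ?A = "{S. S \<subseteq> V \<and> card S = k}"
  have fin: "finite ?A" using assms(1) by auto
  have ne: "?A \<noteq> {}" using obtain_subset_with_card_n[OF assms(2)] by blast
  have "?A \<inter> {S. card {e \<in> E. e \<subseteq> S} = l} =
      {S. S \<subseteq> V \<and> card S = k \<and> card {e \<in> E. e \<subseteq> S} = l}" by auto
  then show ?thesis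
    unfolding I_prob_def using fin ne assms(1) by (simp add: measure_pmf_of_set n_subsets)
qed

lemma I_values_nonempty: "I_values Q n k l \<noteq> {}"
proof -
  have "I_prob {..<n} {} k l \<in> I_values Q n k l"
    unfolding I_values_def hypergraph_def
    by (rule CollectI, rule exI[of _ "{..<n}"], rule exI[of _ "{}"]) simp
  then show ?thesis by blast
qed

lemma finite_I_values:
  assumes "k \<le> n"
  shows "finite (I_values Q n k l)"
proof (rule finite_subset)
  show "I_values Q n k l \<subseteq> (\<lambda>i. real i / (n choose k)) ` {..n choose k}"
  proof
    fix x assume "x \<in> I_values Q n k l"
    then obtain V :: "nat set" and E where V: "x = I_prob V E k l" "finite V" "card V = n"
      unfolding I_values_def hypergraph_def by blast
    have "card {S. S \<subseteq> V \<and> card S = k \<and> card {e \<in> E. e \<subseteq> S} = l} \<le> card {S. S \<subseteq> V \<and> card S = k}"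
      using V by (intro card_mono) auto
    then show "x \<in> (\<lambda>i. real i / (n choose k)) ` {..n choose k}"
      using V assms by (auto simp: I_prob_eq n_subsets)
  qed
qed simp

lemma Max_I_values_Suc_le:
  assumes "k \<le> n"
  shows "Max (I_values Q (Suc n) k l) \<le> Max (I_values Q n k l)"
proof -
  define M where "M = Max (I_values Q n k l)"
  have "x \<le> M" if x: "x \<in> I_values Q (Suc n) k l" for x
  proof -
    obtain V :: "nat set" and E where V: "x = I_prob V E k l" "hypergraph V E" "card V = Suc n"
      "\<forall>e\<in>E. Q (card e)"
      using x unfolding I_values_def by blast
    have finV: "finite V" using V(2) by (simp add: hypergraph_def)
    define G where "G = {S. S \<subseteq> V \<and> card S = k \<and> card {e \<in> E. e \<subseteq> S} = l}"
    have finG: "finite G" using finV by (simp add: G_def)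
    have each: "real (card {S \<in> G. v \<notin> S}) \<le> M * (n choose k)" if "v \<in> V" for v
    proof -
      let ?V = "V - {v}" and ?E = "{e \<in> E. v \<notin> e}"
      have c: "card ?V = n" using V(3) that finV by simp
      have "hypergraph ?V ?E" using V(2) unfolding hypergraph_def by auto
      then have "I_prob ?V ?E k l \<in> I_values Q n k l"
        unfolding I_values_def using c V(4) by blast
      then have "I_prob ?V ?E k l \<le> M"
        unfolding M_def using finite_I_values[OF assms] by simp
      moreover have "{S. S \<subseteq> ?V \<and> card S = k \<and> card {e \<in> ?E. e \<subseteq> S} = l} = {S \<in> G. v \<notin> S}"
      proof -
        have E: "{e \<in> E. v \<notin> e \<and> e \<subseteq> S} = {e \<in> E. e \<subseteq> S}" if "v \<notin> S" for S using that by auto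
        have "S \<subseteq> ?V \<and> card S = k \<and> card {e \<in> ?E. e \<subseteq> S} = l \<longleftrightarrow> S \<in> G \<and> v \<notin> S" for S
        proof (cases "v \<in> S")
          case True
          then show ?thesis by blast
        next
          case False
          then have "S \<subseteq> ?V \<longleftrightarrow> S \<subseteq> V" by blast
          then show ?thesis using False by (simp add: G_def E)
        qed
        then show ?thesis by (rule Collect_cong)
      qed
      then have "I_prob ?V ?E k l = card {S \<in> G. v \<notin> S} / (n choose k)"
        using I_prob_eq[of ?V k ?E l] finV c assms by simp
      moreover have "0 < n choose k" using assms by simp
      ultimately show ?thesis by (simp add: pos_divide_le_eq)
    qed
    have "(\<Sum>v\<in>V. card {S \<in> G. v \<notin> S}) = (\<Sum>v\<in>V. \<Sum>S\<in>G. if v \<notin> S then 1 else 0)"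
      using finG by (intro sum.cong) (auto simp: sum.If_cases Int_def)
    also have "\<dots> = (\<Sum>S\<in>G. \<Sum>v\<in>V. if v \<notin> S then 1 else 0)"
      by (rule sum.swap)
    also have "\<dots> = (\<Sum>S\<in>G. Suc n - k)"
    proof (rule sum.cong)
      fix S assume "S \<in> G"
      then have S: "S \<subseteq> V" "card S = k" by (auto simp: G_def)
      have "(\<Sum>v\<in>V. if v \<notin> S then 1 else 0) = card (V - S)"
        using finV by (auto simp: sum.If_cases Int_def intro!: arg_cong[where f = card])
      then show "(\<Sum>v\<in>V. if v \<notin> S then 1 else 0) = Suc n - k"
        using S V(3) finV by (simp add: card_Diff_subset finite_subset)
    qed simp
    finally have count: "(\<Sum>v\<in>V. card {S \<in> G. v \<notin> S}) = card G * (Suc n - k)" by simp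
    have "real (card G * (Suc n - k)) = (\<Sum>v\<in>V. real (card {S \<in> G. v \<notin> S}))"
      by (simp flip: count)
    also have "\<dots> \<le> (\<Sum>v\<in>V. M * (n choose k))"
      by (intro sum_mono each)
    also have "\<dots> = M * real (Suc n * (n choose k))"
      using V(3) by (simp add: algebra_simps)
    also have "Suc n * (n choose k) = (Suc n choose k) * (Suc n - k)"
      using binomial_absorb_comp[of "Suc n" k] by (simp add: mult.commute)
    finally have "real (card G) * real (Suc n - k) \<le> M * real (Suc n choose k) * real (Suc n - k)"
      by (simp only: of_nat_mult mult.assoc)
    then have "real (card G) \<le> M * real (Suc n choose k)"
      using assms by (simp add: mult_le_cancel_right)
    moreover have "0 < Suc n choose k" using assms by simp
    ultimately have "card G / (Suc n choose k) \<le> M" by (simp add: pos_divide_le_eq del: binomial_Suc_Suc)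
    then show ?thesis
      using V(1,3) I_prob_eq[of V k E l] finV assms by (simp add: G_def del: binomial_Suc_Suc)
  qed
  then show ?thesis
    using finite_I_values[of k "Suc n" Q l] I_values_nonempty[of Q "Suc n" k l] assms
    by (simp add: M_def)
qed

lemma convergent_Max_I_values: "convergent (\<lambda>n. Max (I_values Q n k l))"
proof -
  have "decseq (\<lambda>n. Max (I_values Q (n + k) k l))"
    by (intro decseq_SucI) (simp add: Max_I_values_Suc_le)
  moreover have "0 \<le> Max (I_values Q (n + k) k l)" for n
  proof -
    have "Max (I_values Q (n + k) k l) \<in> I_values Q (n + k) k l"
      by (intro Max_in finite_I_values I_values_nonempty) simp
    then show ?thesis unfolding I_values_def I_prob_def by auto
  qed
  ultimately have "convergent (\<lambda>n. Max (I_values Q (n + k) k l))"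
    using decseq_convergent[of _ 0] by (metis convergentI)
  then show ?thesis by (subst (asm) convergent_ignore_initial_segment)
qed

lemma I_unif_tendsto: "(\<lambda>n. I_unif r n k l) \<longlonglongrightarrow> ind_unif r k l"
  unfolding ind_unif_def I_unif_eq using convergent_Max_I_values by (simp add: convergent_LIMSEQ_iff)

lemma I_le_tendsto: "(\<lambda>n. I_le r n k l) \<longlonglongrightarrow> ind_le r k l"
  unfolding ind_le_def I_le_eq using convergent_Max_I_values by (simp add: convergent_LIMSEQ_iff)

end

theory Submission
  imports Defs "HOL-Real_Asymp.Real_Asymp"
begin

text \<open>Pick vertices independently and uniformly one at a time; repetitions are
  negligible as the number of vertices tends to infinity. A \<open>k\<close>-set with exactly
  \<open>l\<close> edges has at least \<open>k - r l\<close> vertices outside all of these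
  edges, so it suffices to bound by \<open>1/e\<close> the probability that there are exactly
  \<open>l\<close> edges both before and after the last step. This event demands that some
  step creating new edges, and bringing their number to \<open>l\<close>, is followed only by
  steps creating none. As a step creating no edge from a larger set creates none from a
  smaller one, an optimal stopping argument in the style of Bruss' odds theorem applies: if
  \<open>t\<close> is the probability of creating no edge at all, the event has probability at
  most \<open>- t ln t\<close> for \<open>t \<ge> 1/e\<close>, and at most \<open>1/e\<close>
  otherwise.\<close>

definition stopping_bound :: "real \<Rightarrow> real" where
  "stopping_bound t = (let s = max t (exp (-1)) in - (s * ln s))"

lemma neg_mult_ln_le_tangent:
  fixes a x :: real
  assumes "0 < a" "0 < x"
  shows "- (x * ln x) \<le> a - x * (1 + ln a)"
proof -
  have "x * ln (a / x) \<le> x * (a / x - 1)"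
    using assms ln_le_minus_one[of "a / x"] by (intro mult_left_mono) auto
  then show ?thesis using assms by (simp add: ln_div algebra_simps)
qed

lemma stopping_bound_le_tangent:
  assumes "exp (-1) \<le> a"
  shows "stopping_bound t \<le> a - t * (1 + ln a)"
proof -
  define s where "s = max t (exp (-1))"
  have "0 < s" by (simp add: s_def less_max_iff_disj)
  have "0 < a" using assms by (meson exp_gt_zero less_le_trans)
  then have "0 \<le> 1 + ln a" using assms ln_ge_iff[of a "-1"] by simp
  then have "t * (1 + ln a) \<le> s * (1 + ln a)"
    by (intro mult_right_mono) (simp_all add: s_def)
  moreover have "- (s * ln s) \<le> a - s * (1 + ln a)"
    using \<open>0 < a\<close> \<open>0 < s\<close> by (rule neg_mult_ln_le_tangent)
  ultimately show ?thesis by (simp add: stopping_bound_def Let_def flip: s_def)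
qed

lemma stopping_bound_eq_tangent:
  assumes "a = max t (exp (-1))"
  shows "stopping_bound t = a - t * (1 + ln a)"
  using assms by (cases "exp (-1) \<le> t") (simp_all add: stopping_bound_def max_def algebra_simps)

lemma stopping_bound_le_exp: "stopping_bound t \<le> exp (-1)"
  using stopping_bound_le_tangent[of "exp (-1)" t] by simp

lemma sum_stopping_bound_le:
  assumes "finite A"
  shows "(\<Sum>x\<in>A. stopping_bound (f x)) \<le> card A * stopping_bound ((\<Sum>x\<in>A. f x) / card A)"
proof (cases "A = {}")
  case False
  define mean where "mean = (\<Sum>x\<in>A. f x) / card A"
  define a where "a = max mean (exp (-1))"
  have "(\<Sum>x\<in>A. stopping_bound (f x)) \<le> (\<Sum>x\<in>A. a - f x * (1 + ln a))"
    by (intro sum_mono stopping_bound_le_tangent) (simp add: a_def)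
  also have "\<dots> = card A * a - card A * mean * (1 + ln a)"
    using assms False by (simp add: mean_def sum_subtractf flip: sum_distrib_right)
  also have "\<dots> = card A * stopping_bound mean"
    by (simp add: stopping_bound_eq_tangent[OF a_def] algebra_simps)
  finally show ?thesis by (simp add: mean_def)
qed simp

text \<open>In the stopping argument \<open>c\<close> is the probability that the next step creates no edge, so \<open>t / c\<close>
  is the mean, over such steps, of the probability that the remaining ones create none either.\<close>

lemma mixture_le_stopping_bound:
  assumes "0 \<le> c" "c \<le> 1" "t \<le> c"
  shows "(1 - c) * max t (exp (-1)) + c * stopping_bound (t / c) \<le> stopping_bound t"
proof (cases "t \<le> exp (-1)")
  case True
  have "c * stopping_bound (t / c) \<le> c * exp (-1)"
    using assms(1) by (intro mult_left_mono stopping_bound_le_exp)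
  moreover have "stopping_bound t = exp (-1)"
    using True by (simp add: stopping_bound_def max_def)
  ultimately show ?thesis using True by (simp add: max_def algebra_simps)
next
  case False
  then have "0 < t" by (meson exp_gt_zero less_trans not_le)
  then have "0 < c" using assms(3) by simp
  have "t \<le> t / c" using \<open>0 < t\<close> \<open>0 < c\<close> assms(2) by (simp add: pos_le_divide_eq)
  then have "c * stopping_bound (t / c) = t * ln c - t * ln t"
    using False \<open>0 < t\<close> \<open>0 < c\<close>
    by (simp add: stopping_bound_def max_absorb1 ln_div algebra_simps)
  moreover have "t * ln c \<le> t * (c - 1)"
    using \<open>0 < t\<close> \<open>0 < c\<close> by (intro mult_left_mono ln_le_minus_one) auto
  ultimately show ?thesis
    using False by (simp add: stopping_bound_def max_absorb1 algebra_simps)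
qed

definition supersets :: "'a set \<Rightarrow> nat \<Rightarrow> 'a set \<Rightarrow> 'a set set" where
  "supersets V m R = {S. R \<subseteq> S \<and> S \<subseteq> V \<and> card S = card R + m}"

lemma finite_supersets: "finite V \<Longrightarrow> finite (supersets V m R)"
  by (rule finite_subset[of _ "Pow V"]) (auto simp: supersets_def)

lemma supersets_0:
  assumes "finite V" "R \<subseteq> V"
  shows "supersets V 0 R = {R}"
proof -
  have "S = R" if "S \<in> supersets V 0 R" for S
    using that assms(1) card_subset_eq[of S R] finite_subset[of S V] by (simp add: supersets_def)
  then show ?thesis using assms(2) by (auto simp: supersets_def)
qed

lemma supersets_insert:
  assumes "finite R" "v \<in> V - R"
  shows "supersets V m (insert v R) = {S \<in> supersets V (Suc m) R. v \<in> S}"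
  using assms by (auto simp: supersets_def)

lemma sum_supersets_insert:
  fixes f :: "'a set \<Rightarrow> 'b :: comm_semiring_1"
  assumes "finite V" "R \<subseteq> V"
  shows "(\<Sum>v\<in>V - R. \<Sum>S\<in>supersets V m (insert v R). f S)
    = of_nat (Suc m) * (\<Sum>S\<in>supersets V (Suc m) R. f S)"
proof -
  have "finite R" using assms(2,1) by (rule finite_subset)
  then have "(\<Sum>v\<in>V - R. \<Sum>S\<in>supersets V m (insert v R). f S)
      = (\<Sum>v\<in>V - R. \<Sum>S | S \<in> supersets V (Suc m) R \<and> v \<in> S. f S)"
    by (intro sum.cong refl) (simp add: supersets_insert)
  also have "\<dots> = (\<Sum>S\<in>supersets V (Suc m) R. \<Sum>v | v \<in> V - R \<and> v \<in> S. f S)"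
    using assms(1) by (intro sum.swap_restrict finite_supersets) simp_all
  also have "\<dots> = (\<Sum>S\<in>supersets V (Suc m) R. of_nat (Suc m) * f S)"
  proof (rule sum.cong)
    fix S assume S: "S \<in> supersets V (Suc m) R"
    then have "{v. v \<in> V - R \<and> v \<in> S} = S - R" by (auto simp: supersets_def)
    moreover have "card (S - R) = Suc m"
      using S \<open>finite R\<close> by (simp add: supersets_def card_Diff_subset)
    ultimately show "(\<Sum>v | v \<in> V - R \<and> v \<in> S. f S) = of_nat (Suc m) * f S" by simp
  qed simp
  finally show ?thesis by (simp only: sum_distrib_left)
qed

lemma sum_card_insertions_eq_sum_card_elements:
  assumes "finite V"
  shows "(\<Sum>R | R \<subseteq> V \<and> card R = m. card {v \<in> V - R. P v (insert v R)})
    = (\<Sum>S | S \<subseteq> V \<and> card S = Suc m. card {v \<in> S. P v S})"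
proof -
  have "(\<Sum>R | R \<subseteq> V \<and> card R = m. card {v \<in> V - R. P v (insert v R)})
      = card (SIGMA R:{R. R \<subseteq> V \<and> card R = m}. {v \<in> V - R. P v (insert v R)})"
    using assms by simp
  also have "\<dots> = card (SIGMA S:{S. S \<subseteq> V \<and> card S = Suc m}. {v \<in> S. P v S})"
    by (rule bij_betw_same_card[OF bij_betw_byWitness
          [where f = "\<lambda>(R, v). (insert v R, v)" and f' = "\<lambda>(S, v). (S - {v}, v)"]])
      (auto simp: insert_absorb finite_subset[OF _ assms])
  also have "\<dots> = (\<Sum>S | S \<subseteq> V \<and> card S = Suc m. card {v \<in> S. P v S})"
    using assms by (intro card_SigmaI) (auto intro: finite_subset)
  finally show ?thesis .
qed

locale finite_hypergraph =
  fixes V :: "'a set" and E :: "'a set set"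
  assumes hypergraph: "hypergraph V E" and nonempty [simp]: "V \<noteq> {}"
begin

definition edges_in :: "'a set \<Rightarrow> 'a set set" where
  "edges_in R = {e \<in> E. e \<subseteq> R}"

abbreviation num_edges :: "'a set \<Rightarrow> nat" where
  "num_edges R \<equiv> card (edges_in R)"

definition isolated :: "'a set \<Rightarrow> 'a set" where
  "isolated R = R - \<Union> (edges_in R)"

definition idle :: "'a set \<Rightarrow> 'a set" where
  "idle R = {v \<in> V - R. v \<in> isolated (insert v R)}"

text \<open>The probability that \<open>m\<close> random vertices added to \<open>R\<close> are all new and create no edge. Drawing
  a vertex that is already present counts as a failure, since \<open>idle\<close> would otherwise not be antitone.\<close>

fun stay :: "nat \<Rightarrow> 'a set \<Rightarrow> real" where
  "stay 0 R = 1"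
| "stay (Suc m) R = (\<Sum>v\<in>idle R. stay m (insert v R)) / card V"

text \<open>The probability that \<open>m + 1\<close> random vertices added to \<open>R\<close> are all new and that there are
  exactly \<open>l\<close> edges both after \<open>m\<close> and after \<open>m + 1\<close> steps.\<close>

fun hit :: "nat \<Rightarrow> nat \<Rightarrow> 'a set \<Rightarrow> real" where
  "hit l 0 R = (if num_edges R = l then card (idle R) / card V else 0)"
| "hit l (Suc m) R = (\<Sum>v\<in>V - R. hit l m (insert v R)) / card V"

lemma finite_V [simp]: "finite V"
  using hypergraph by (simp add: hypergraph_def)

lemma finite_edges_in [simp]: "finite (edges_in R)"
proof (rule finite_subset)
  show "edges_in R \<subseteq> Pow V"
    using hypergraph by (auto simp: edges_in_def hypergraph_def)
qed simp

lemma edges_in_empty [simp]: "edges_in {} = {}"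
  using hypergraph by (auto simp: edges_in_def hypergraph_def)

lemma edges_in_mono: "A \<subseteq> B \<Longrightarrow> edges_in A \<subseteq> edges_in B"
  by (auto simp: edges_in_def)

lemma idle_subset: "idle R \<subseteq> V - R"
  by (auto simp: idle_def)

lemma finite_idle [simp]: "finite (idle R)"
  by (rule finite_subset[OF idle_subset]) simp

lemma card_idle_le: "card (idle R) \<le> card V"
  using idle_subset[of R] by (intro card_mono) auto

lemma idle_antimono: "A \<subseteq> B \<Longrightarrow> idle B \<subseteq> idle A"
  unfolding idle_def isolated_def edges_in_def by blast

lemma edges_in_insert_idle: "v \<in> idle R \<Longrightarrow> edges_in (insert v R) = edges_in R"
  unfolding idle_def isolated_def edges_in_def by blast

lemma num_edges_insert_not_idle:
  assumes "v \<in> V - R - idle R"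
  shows "num_edges R < num_edges (insert v R)"
proof (intro psubset_card_mono psubsetI edges_in_mono)
  show "edges_in R \<noteq> edges_in (insert v R)"
    using assms unfolding idle_def isolated_def edges_in_def by blast
qed auto

lemma stay_nonneg: "0 \<le> stay m R"
  by (induction m arbitrary: R) (auto intro!: divide_nonneg_nonneg sum_nonneg)

lemma stay_antimono: "A \<subseteq> B \<Longrightarrow> stay m B \<le> stay m A"
proof (induction m arbitrary: A B)
  case (Suc m)
  have "(\<Sum>v\<in>idle B. stay m (insert v B)) \<le> (\<Sum>v\<in>idle B. stay m (insert v A))"
    using Suc.prems by (intro sum_mono Suc.IH) auto
  also have "\<dots> \<le> (\<Sum>v\<in>idle A. stay m (insert v A))"
    using idle_antimono[OF Suc.prems] by (intro sum_mono2) (auto simp: stay_nonneg)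
  finally show ?case by (simp add: divide_right_mono)
qed simp

lemma stay_le_1: "stay m R \<le> 1"
proof (induction m arbitrary: R)
  case (Suc m)
  have "(\<Sum>v\<in>idle R. stay m (insert v R)) \<le> (\<Sum>v\<in>idle R. 1)"
    by (intro sum_mono Suc.IH)
  also have "\<dots> \<le> card V" by (simp add: card_idle_le)
  finally show ?case by (simp add: divide_le_eq)
qed simp

lemma stay_Suc_le: "stay (Suc m) R \<le> card (idle R) / card V"
proof -
  have "(\<Sum>v\<in>idle R. stay m (insert v R)) \<le> (\<Sum>v\<in>idle R. 1)"
    by (intro sum_mono stay_le_1)
  then show ?thesis by (simp add: divide_right_mono)
qed

lemma hit_eq_0:
  assumes "l < num_edges R"
  shows "hit l m R = 0"
  using assms
proof (induction m arbitrary: R)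
  case (Suc m)
  have "l < num_edges (insert v R)" for v
    using Suc.prems card_mono[OF finite_edges_in edges_in_mono[OF subset_insertI]]
    by (rule less_le_trans)
  then show ?case by (simp add: Suc.IH)
qed simp

lemma hit_eq_stay:
  assumes "num_edges R = l"
  shows "hit l m R = stay (Suc m) R"
  using assms
proof (induction m arbitrary: R)
  case (Suc m)
  have "(\<Sum>v\<in>V - R. hit l m (insert v R)) = (\<Sum>v\<in>idle R. hit l m (insert v R))"
    using num_edges_insert_not_idle Suc.prems
    by (intro sum.mono_neutral_right idle_subset ballI hit_eq_0) auto
  also have "\<dots> = (\<Sum>v\<in>idle R. stay (Suc m) (insert v R))"
    using Suc.prems by (intro sum.cong refl Suc.IH) (simp add: edges_in_insert_idle)
  finally show ?case by simp
qed simp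

lemma hit_Suc_le:
  assumes "0 \<le> M" and "\<And>v. v \<in> V - R - idle R \<Longrightarrow> hit l m (insert v R) \<le> M"
  shows "hit l (Suc m) R
    \<le> (1 - card (idle R) / card V) * M + (\<Sum>v\<in>idle R. hit l m (insert v R)) / card V"
proof -
  have "(\<Sum>v\<in>V - R - idle R. hit l m (insert v R)) \<le> card (V - R - idle R) * M"
    using assms(2) by (intro sum_bounded_above)
  also have "\<dots> \<le> card (V - idle R) * M"
    using assms(1) by (intro mult_right_mono of_nat_mono card_mono) auto
  also have "card (V - idle R) = card V - card (idle R)"
    using idle_subset[of R] by (intro card_Diff_subset) auto
  also have "real \<dots> = real (card V) - real (card (idle R))"
    by (rule of_nat_diff) (rule card_idle_le)
  finally have "(\<Sum>v\<in>V - R. hit l m (insert v R))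
      \<le> (real (card V) - real (card (idle R))) * M + (\<Sum>v\<in>idle R. hit l m (insert v R))"
    by (simp add: sum.subset_diff[OF idle_subset])
  then have "hit l (Suc m) R \<le> ((real (card V) - real (card (idle R))) * M
      + (\<Sum>v\<in>idle R. hit l m (insert v R))) / card V"
    by (simp add: divide_right_mono)
  then show ?thesis
    by (simp add: add_divide_distrib diff_divide_distrib left_diff_distrib)
qed

lemma hit_le_stopping_bound:
  assumes "num_edges R < l"
  shows "hit l m R \<le> stopping_bound (stay m R)"
  using assms
proof (induction m arbitrary: R)
  case 0
  then show ?case by (simp add: stopping_bound_def max_def)
next
  case (Suc m)
  define t where "t = stay (Suc m) R"
  define c where "c = card (idle R) / card V"
  have "hit l m (insert v R) \<le> max t (exp (-1))" if "v \<in> V - R" for v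
  proof (cases "num_edges (insert v R)" l rule: linorder_cases)
    case less
    then show ?thesis
      using order_trans[OF Suc.IH stopping_bound_le_exp] by (simp add: le_max_iff_disj)
  next
    case equal
    then have "hit l m (insert v R) \<le> t"
      unfolding t_def hit_eq_stay[OF equal] by (intro stay_antimono) auto
    then show ?thesis by simp
  next
    case greater
    then show ?thesis by (simp add: hit_eq_0 le_max_iff_disj)
  qed
  then have "hit l (Suc m) R
      \<le> (1 - c) * max t (exp (-1)) + (\<Sum>v\<in>idle R. hit l m (insert v R)) / card V"
    unfolding c_def by (intro hit_Suc_le) (auto simp: le_max_iff_disj)
  also have "(\<Sum>v\<in>idle R. hit l m (insert v R))
      \<le> (\<Sum>v\<in>idle R. stopping_bound (stay m (insert v R)))"
    using Suc.prems by (intro sum_mono Suc.IH) (simp add: edges_in_insert_idle)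
  also have "\<dots> \<le> card (idle R) * stopping_bound (t / c)"
    using sum_stopping_bound_le[OF finite_idle, of "\<lambda>v. stay m (insert v R)"]
    by (simp add: t_def c_def)
  also have "(1 - c) * max t (exp (-1)) + card (idle R) * stopping_bound (t / c) / card V
      = (1 - c) * max t (exp (-1)) + c * stopping_bound (t / c)"
    by (simp add: c_def)
  also have "\<dots> \<le> stopping_bound t"
    using card_idle_le stay_Suc_le unfolding c_def t_def
    by (intro mixture_le_stopping_bound) (simp_all add: divide_le_eq del: stay.simps)
  finally show ?case by (simp add: t_def divide_right_mono)
qed

lemma hit_eq_sum_supersets:
  assumes "R \<subseteq> V"
  shows "hit l m R = fact m
    * real (\<Sum>S\<in>supersets V m R. if num_edges S = l then card (idle S) else 0) / card V ^ Suc m"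
  using assms
proof (induction m arbitrary: R)
  case 0
  then show ?case by (simp add: supersets_0)
next
  case (Suc m)
  let ?f = "\<lambda>S. if num_edges S = l then card (idle S) else 0"
  have "(\<Sum>v\<in>V - R. hit l m (insert v R))
      = (\<Sum>v\<in>V - R. fact m * real (\<Sum>S\<in>supersets V m (insert v R). ?f S) / card V ^ Suc m)"
    using Suc.prems by (intro sum.cong refl Suc.IH) auto
  also have "\<dots> = fact m * real (\<Sum>v\<in>V - R. \<Sum>S\<in>supersets V m (insert v R). ?f S)
      / card V ^ Suc m"
    by (simp only: of_nat_sum sum_distrib_left sum_divide_distrib)
  also have "\<dots> = fact m * real (Suc m * (\<Sum>S\<in>supersets V (Suc m) R. ?f S)) / card V ^ Suc m"
    unfolding sum_supersets_insert[OF finite_V Suc.prems] of_nat_id ..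
  also have "\<dots> = fact (Suc m) * real (\<Sum>S\<in>supersets V (Suc m) R. ?f S) / card V ^ Suc m"
    by (simp only: fact_Suc of_nat_mult mult_ac)
  finally show ?case by simp
qed

lemma hit_empty_eq_sum_card_isolated:
  "hit l m {} = fact m * real (\<Sum>S | S \<subseteq> V \<and> card S = Suc m \<and> num_edges S = l. card (isolated S))
    / card V ^ Suc m"
proof -
  define P where "P = (\<lambda>v S. v \<in> isolated S \<and> num_edges S = l)"
  have "{v \<in> V - R. P v (insert v R)} = {v \<in> idle R. num_edges R = l}" for R
    using edges_in_insert_idle[of _ R] by (auto simp: P_def idle_def)
  then have insertions: "card {v \<in> V - R. P v (insert v R)}
      = (if num_edges R = l then card (idle R) else 0)" for R
    by simp
  have "{v \<in> S. P v S} = {v \<in> isolated S. num_edges S = l}" for S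
    by (auto simp: P_def isolated_def)
  then have elements: "card {v \<in> S. P v S} = (if num_edges S = l then card (isolated S) else 0)" for S
    by simp
  have "(\<Sum>S\<in>supersets V m {}. if num_edges S = l then card (idle S) else 0)
      = (\<Sum>S | S \<subseteq> V \<and> card S = Suc m. if num_edges S = l then card (isolated S) else 0)"
    using sum_card_insertions_eq_sum_card_elements[OF finite_V, where m = m and P = P]
    unfolding insertions elements by (simp add: supersets_def)
  also have "\<dots> = (\<Sum>S | S \<subseteq> V \<and> card S = Suc m \<and> num_edges S = l. card (isolated S))"
    by (simp add: sum.inter_filter[symmetric] conj_assoc)
  finally show ?thesis by (simp only: hit_eq_sum_supersets[OF empty_subsetI])
qed

lemma card_le_card_isolated:
  assumes "edges_size_le r E" "finite S"
  shows "card S \<le> card (isolated S) + r * num_edges S"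
proof -
  have "card (\<Union> (edges_in S)) \<le> (\<Sum>e\<in>edges_in S. card e)"
    by (rule card_Union_le_sum_card)
  also have "\<dots> \<le> num_edges S * r"
    using assms(1) sum_bounded_above[of "edges_in S" card r]
    by (auto simp: edges_size_le_def edges_in_def)
  finally have "card (\<Union> (edges_in S)) \<le> r * num_edges S" by (simp add: mult.commute)
  moreover have "\<Union> (edges_in S) \<subseteq> S" by (auto simp: edges_in_def)
  then have "card (isolated S) = card S - card (\<Union> (edges_in S))"
    unfolding isolated_def using assms(2) by (intro card_Diff_subset) (rule finite_subset)
  ultimately show ?thesis by linarith
qed

lemma card_subsets_num_edges_le:
  assumes "edges_size_le r E" "0 < l" "0 < k"
  shows "(real k - real r * real l) * card {S. S \<subseteq> V \<and> card S = k \<and> num_edges S = l} * fact k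
    \<le> real k * exp (-1) * card V ^ k"
proof -
  let ?F = "{S. S \<subseteq> V \<and> card S = k \<and> num_edges S = l}"
  obtain m where m: "k = Suc m" using assms(3) by (cases k) auto
  have "(real k - real r * real l) * card ?F = (\<Sum>S\<in>?F. real k - real r * real l)"
    by simp
  also have "\<dots> \<le> (\<Sum>S\<in>?F. real (card (isolated S)))"
  proof (rule sum_mono)
    fix S assume "S \<in> ?F"
    then have "k \<le> card (isolated S) + r * l"
      using card_le_card_isolated[OF assms(1), of S] finite_subset[OF _ finite_V] by auto
    then show "real k - real r * real l \<le> card (isolated S)"
      by (simp add: diff_le_eq flip: of_nat_mult of_nat_add)
  qed
  finally have "(real k - real r * real l) * card ?F * fact m
      \<le> (\<Sum>S\<in>?F. real (card (isolated S))) * fact m"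
    by (rule mult_right_mono) simp
  also have "\<dots> = hit l m {} * card V ^ k"
    by (simp add: hit_empty_eq_sum_card_isolated m)
  also have "\<dots> \<le> exp (-1) * card V ^ k"
    using assms(2) order_trans[OF hit_le_stopping_bound stopping_bound_le_exp]
    by (intro mult_right_mono) simp_all
  finally have "real k * ((real k - real r * real l) * card ?F * fact m)
      \<le> real k * (exp (-1) * card V ^ k)"
    by (rule mult_left_mono) simp
  moreover have "fact k = real k * fact m" by (simp add: m)
  ultimately show ?thesis by (simp add: mult_ac)
qed

end

lemma I_prob_mult_le:
  assumes "hypergraph V E" "edges_size_le r E" "0 < l" "r * l < k" "k \<le> card V"
  shows "I_prob V E k l * (real (card V choose k) * fact k / card V ^ k)
    \<le> real k / (real k - real r * real l) * (1 / exp 1)"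
proof -
  have "0 < card V" using assms(4,5) by simp
  then have "V \<noteq> {}" by auto
  then interpret finite_hypergraph V E using assms(1) by unfold_locales
  let ?N = "real (card {S. S \<subseteq> V \<and> card S = k \<and> num_edges S = l})"
  have "I_prob V E k l * (real (card V choose k) * fact k / card V ^ k) = ?N * fact k / card V ^ k"
    using assms(5) by (simp add: I_prob_eq edges_in_def)
  also have "\<dots> \<le> real k / (real k - real r * real l) * exp (-1)"
  proof -
    have "0 < real k - real r * real l" using assms(4) by (simp flip: of_nat_mult)
    moreover note \<open>0 < card V\<close>
    moreover have "(real k - real r * real l) * ?N * fact k \<le> real k * exp (-1) * card V ^ k"
      using assms(2-4) by (intro card_subsets_num_edges_le) auto
    ultimately show ?thesis by (simp add: field_simps)
  qed
  finally show ?thesis by (simp add: exp_minus inverse_eq_divide)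
qed

lemma binomial_mult_fact_div_power_tendsto_1:
  "(\<lambda>n. real (n choose k) * fact k / real n ^ k) \<longlonglongrightarrow> 1"
proof (rule LIMSEQ_offset)
  have "(\<lambda>n. real n / real (n + k)) \<longlonglongrightarrow> 1" by real_asymp
  then have "(\<lambda>n. real (k + n choose n) / (real (n ^ k) / fact k) * (real n / real (n + k)) ^ k)
      \<longlonglongrightarrow> 1 * 1 ^ k"
    by (intro tendsto_mult tendsto_power binomial_asymptotic')
  moreover have "\<forall>\<^sub>F n in sequentially.
      real (k + n choose n) / (real (n ^ k) / fact k) * (real n / real (n + k)) ^ k
      = real (n + k choose k) * fact k / real (n + k) ^ k"
    using eventually_gt_at_top[of 0]
  proof eventually_elim
    case (elim n)
    then show ?case
      using binomial_symmetric[of k "n + k"] by (simp add: power_divide add.commute)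
  qed
  ultimately show "(\<lambda>n. real (n + k choose k) * fact k / real (n + k) ^ k) \<longlonglongrightarrow> 1"
    by (simp add: tendsto_cong)
qed

lemma ind_unif_le_ind_le: "ind_unif r k l \<le> ind_le r k l"
proof (rule LIMSEQ_le[OF I_unif_tendsto I_le_tendsto])
  have "I_unif r n k l \<le> I_le r n k l" if "k \<le> n" for n
    unfolding I_unif_eq I_le_eq
  proof (rule Max_mono)
    show "I_values (\<lambda>s. s = r) n k l \<subseteq> I_values (\<lambda>s. s \<le> r) n k l"
      unfolding I_values_def by fastforce
  qed (simp_all add: I_values_nonempty finite_I_values that)
  then show "\<exists>N. \<forall>n\<ge>N. I_unif r n k l \<le> I_le r n k l" by blast
qed

lemma I_le_attained:
  assumes "k \<le> n"
  obtains V :: "nat set" and E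
  where "hypergraph V E" "edges_size_le r E" "card V = n" "I_le r n k l = I_prob V E k l"
proof -
  have "I_le r n k l \<in> I_values (\<lambda>s. s \<le> r) n k l"
    unfolding I_le_eq using assms by (intro Max_in finite_I_values I_values_nonempty)
  then show ?thesis using that unfolding I_values_def edges_size_le_def by blast
qed

lemma ind_le_upper_bound:
  assumes "0 < l" "r * l < k"
  shows "ind_le r k l \<le> real k / (real k - real r * real l) * (1 / exp 1)"
proof (rule LIMSEQ_le_const2)
  show "(\<lambda>n. I_le r n k l * (real (n choose k) * fact k / real n ^ k)) \<longlonglongrightarrow> ind_le r k l"
    using tendsto_mult[OF I_le_tendsto binomial_mult_fact_div_power_tendsto_1] by simp
  have "I_le r n k l * (real (n choose k) * fact k / real n ^ k)
      \<le> real k / (real k - real r * real l) * (1 / exp 1)" if n: "k \<le> n" for n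
  proof -
    obtain V :: "nat set" and E where "hypergraph V E" "edges_size_le r E" "card V = n"
      "I_le r n k l = I_prob V E k l"
      by (rule I_le_attained[OF n])
    then show ?thesis using I_prob_mult_le[OF _ _ assms, of V E] n by simp
  qed
  then show "\<exists>N. \<forall>n\<ge>N. I_le r n k l * (real (n choose k) * fact k / real n ^ k)
      \<le> real k / (real k - real r * real l) * (1 / exp 1)" by blast
qed

theorem theorem1p4:
  fixes r k l :: nat
  assumes "r \<ge> 1" and "k \<ge> 1" and "1 \<le> l" and "real l < real k / real r"
  shows "ind_unif r k l \<le> ind_le r k l
    \<and> ind_le r k l \<le> real k / (real k - real r * real l) * (1 / exp 1)"
proof
  show "ind_unif r k l \<le> ind_le r k l" by (rule ind_unif_le_ind_le)
  have "real (r * l) < real k" using assms(1,4) by (simp add: field_simps)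
  then have "r * l < k" by (simp only: of_nat_less_iff)
  with assms(3) show "ind_le r k l \<le> real k / (real k - real r * real l) * (1 / exp 1)"
    by (intro ind_le_upper_bound) simp_all
qed

end
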